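(* Let $\mathcal{L}:\mathcal{S}\to\mathcal{T}$ be a diagrammatic logic, i.e. a pushout-preserving functor between two categories $\mathcal{S}$, $\mathcal{T}$ that have pushouts. Let $l:K\to H$, $r:K\to C$ be a span in $\mathcal{S}$, and let $$\begin{array}{ccc} K & \xrightarrow{\;r\;} & C\\ {\scriptstyle l}\downarrow & & \downarrow{\scriptstyle c}\\ H & \xrightarrow{\;h\;} & P\end{array}$$ be a pushout square in $\mathcal{S}$ (so $h\circ l=c\circ r$), where $h$ is a pleomorphism. (Thus $(c,h)$ is a deduction rule with hypothesis $H$ and conclusion $C$.) Let $\sigma_H:H\to \Sigma_H$ be a morphism in $\mathcal{S}$, and suppose given a pleopushout under $(l,r)$ extending $\sigma_H$: morphisms $\sigma_K:K\to\Sigma_K$, $l_1:\Sigma_K\to\Sigma_H$, $r_1:\Sigma_K\to\Sigma_C$ and $\sigma_C:C\to\Sigma_C$ in $\mathcal{S}$ such that $l_1$ is a pleomorphism, $l_1\circ\sigma_K=\sigma_H\circ l$, and the square formed by $r:K\to C$, $\sigma_K:K\to\Sigma_K$, $\sigma_C:C\to\Sigma_C$, $r_1:\Sigma_K\to\Sigma_C$ (with $\sigma_C\circ r=r_1\circ\sigma_K$) is a pushout. Finally let $h_1:\Sigma_H\to\Sigma_P$, $c_1:\Sigma_C\to\Sigma_P$ be a pushout of the span $(l_1,r_1)$, so $h_1\circ l_1=c_1\circ r_1$. Then there is a unique morphism $\sigma_P:P\to\Sigma_P$ such that $\sigma_P\circ h=h_1\circ\sigma_H$ and $\sigma_P\circ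 c=c_1\circ\sigma_C$. Moreover: (i) the following four commutative squares are pushouts: the square $(l,r,h,c)$ on $K,H,C,P$; the square $(l_1,r_1,h_1,c_1)$ on $\Sigma_K,\Sigma_H,\Sigma_C,\Sigma_P$; the square $(r,\sigma_K,\sigma_C,r_1)$ on $K,C,\Sigma_K,\Sigma_C$; and the square on $H,P,\Sigma_H,\Sigma_P$ formed by $h:H\to P$, $\sigma_H:H\to\Sigma_H$, $\sigma_P:P\to\Sigma_P$, $h_1:\Sigma_H\to\Sigma_P$; (ii) $h$, $l_1$, $r_1$, $h_1$ and $c_1$ are pleomorphisms. Finally, if $\sigma_H$ is an instance of $H$ in some specification $\Sigma$ (i.e. $\Sigma_H$ is pleoequivalent to $\Sigma$), then $\sigma_C:C\to\Sigma_C$ is an instance of $C$ in $\Sigma$ (i.e. $\Sigma_C$ is pleoequivalent to $\Sigma$).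
   Context: A diagrammatic logic is a pushout-preserving functor $\mathcal{L}:\mathcal{S}\to\mathcal{T}$ between two categories with pushouts; objects of $\mathcal{S}$ are called specifications and objects of $\mathcal{T}$ theories. A morphism $\tau$ of $\mathcal{S}$ is a pleomorphism if $\mathcal{L}\tau$ is an isomorphism in $\mathcal{T}$. Two specifications $\Sigma,\Sigma'$ are pleoequivalent if $\mathcal{L}\Sigma\cong\mathcal{L}\Sigma'$ in $\mathcal{T}$. An instance of a specification $\Sigma_1$ in a specification $\Sigma_2$ is a morphism $\Sigma_1\to\Sigma_2'$ in $\mathcal{S}$ where $\Sigma_2'$ is pleoequivalent to $\Sigma_2$. A deduction rule is a cospan $C\xrightarrow{c}P\xleftarrow{h}H$ in $\mathcal{S}$ with $h$ a pleomorphism. A pleopushout under a span $(l:K\to H,\ r:K\to C)$ is a diagram consisting of a commutative square $l_1\circ\sigma_K=\sigma_H\circ l$ with $l_1:\Sigma_K\to\Sigma_H$ a pleomorphism, together with a pushout square $\sigma_C\circ r=r_1\circ\sigma_K$. *)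

theory Defs
  imports Main
begin

section \<open>Categories\<close>

record ('o, 'a) cat =
  Ob :: "'o set"
  Ar :: "'a set"
  Dom :: "'a \<Rightarrow> 'o"
  Cod :: "'a \<Rightarrow> 'o"
  Ident :: "'o \<Rightarrow> 'a"
  Comp :: "'a \<Rightarrow> 'a \<Rightarrow> 'a"  (infixr "\<cdot>\<index>" 75)

text \<open>As for the structures of HOL-Algebra, the operations are total functions, meaningful only on
  \<open>Ob\<close>, \<open>Ar\<close> and composable pairs. The composite \<open>g \<cdot> f\<close> is \<open>g\<close> after \<open>f\<close>.\<close>

definition Hom :: "('o, 'a) cat \<Rightarrow> 'o \<Rightarrow> 'o \<Rightarrow> 'a set"
  where "Hom C A B = {f \<in> Ar C. Dom C f = A \<and> Cod C f = B}"

locale category =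
  fixes C :: "('o, 'a) cat" (structure)
  assumes Dom_in_Ob: "f \<in> Ar C \<Longrightarrow> Dom C f \<in> Ob C"
    and Cod_in_Ob: "f \<in> Ar C \<Longrightarrow> Cod C f \<in> Ob C"
    and Ident_in_Hom: "A \<in> Ob C \<Longrightarrow> Ident C A \<in> Hom C A A"
    and Comp_in_Hom: "\<lbrakk>f \<in> Hom C A B; g \<in> Hom C B D\<rbrakk> \<Longrightarrow> g \<cdot> f \<in> Hom C A D"
    and Comp_Ident: "f \<in> Hom C A B \<Longrightarrow> f \<cdot> Ident C A = f"
    and Ident_Comp: "f \<in> Hom C A B \<Longrightarrow> Ident C B \<cdot> f = f"
    and Comp_assoc: "\<lbrakk>f \<in> Hom C A B; g \<in> Hom C B D; h \<in> Hom C D E\<rbrakk>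
          \<Longrightarrow> (h \<cdot> g) \<cdot> f = h \<cdot> (g \<cdot> f)"

definition iso :: "('o, 'a) cat \<Rightarrow> 'a \<Rightarrow> bool"
  where "iso C f \<longleftrightarrow> f \<in> Ar C \<and>
    (\<exists>g \<in> Hom C (Cod C f) (Dom C f).
      g \<cdot>\<^bsub>C\<^esub> f = Ident C (Dom C f) \<and> f \<cdot>\<^bsub>C\<^esub> g = Ident C (Cod C f))"

definition isomorphic :: "('o, 'a) cat \<Rightarrow> 'o \<Rightarrow> 'o \<Rightarrow> bool"
  where "isomorphic C A B \<longleftrightarrow> (\<exists>f \<in> Hom C A B. iso C f)"

section \<open>Pushouts\<close>

text \<open>In \<open>commutative_square C f g p q\<close> and \<open>pushout C f g p q\<close>, \<open>(f, g)\<close> is the span and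
  \<open>(p, q)\<close> the cospan, with \<open>p\<close> following \<open>f\<close> and \<open>q\<close> following \<open>g\<close>.\<close>

definition commutative_square :: "('o, 'a) cat \<Rightarrow> 'a \<Rightarrow> 'a \<Rightarrow> 'a \<Rightarrow> 'a \<Rightarrow> bool"
  where "commutative_square C f g p q \<longleftrightarrow>
    f \<in> Ar C \<and> g \<in> Ar C \<and> p \<in> Ar C \<and> q \<in> Ar C \<and>
    Dom C f = Dom C g \<and> Cod C f = Dom C p \<and> Cod C g = Dom C q \<and> Cod C p = Cod C q \<and>
    p \<cdot>\<^bsub>C\<^esub> f = q \<cdot>\<^bsub>C\<^esub> g"

definition pushout :: "('o, 'a) cat \<Rightarrow> 'a \<Rightarrow> 'a \<Rightarrow> 'a \<Rightarrow> 'a \<Rightarrow> bool"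
  where "pushout C f g p q \<longleftrightarrow>
    commutative_square C f g p q \<and>
    (\<forall>x y. commutative_square C f g x y \<longrightarrow>
      (\<exists>!u. u \<in> Hom C (Cod C p) (Cod C x) \<and> u \<cdot>\<^bsub>C\<^esub> p = x \<and> u \<cdot>\<^bsub>C\<^esub> q = y))"

definition has_pushouts :: "('o, 'a) cat \<Rightarrow> bool"
  where "has_pushouts C \<longleftrightarrow>
    (\<forall>f \<in> Ar C. \<forall>g \<in> Ar C. Dom C f = Dom C g \<longrightarrow> (\<exists>p q. pushout C f g p q))"

section \<open>Functors and diagrammatic logics\<close>

record ('o1, 'a1, 'o2, 'a2) functor_data =
  ob_map :: "'o1 \<Rightarrow> 'o2"
  ar_map :: "'a1 \<Rightarrow> 'a2"

locale cat_functor = S: category S + T: category T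
  for S :: "('o1, 'a1) cat" and T :: "('o2, 'a2) cat" +
  fixes L :: "('o1, 'a1, 'o2, 'a2) functor_data"
  assumes ob_map_in_Ob: "A \<in> Ob S \<Longrightarrow> ob_map L A \<in> Ob T"
    and ar_map_in_Hom: "f \<in> Hom S A B \<Longrightarrow> ar_map L f \<in> Hom T (ob_map L A) (ob_map L B)"
    and ar_map_Ident: "A \<in> Ob S \<Longrightarrow> ar_map L (Ident S A) = Ident T (ob_map L A)"
    and ar_map_Comp: "\<lbrakk>f \<in> Hom S A B; g \<in> Hom S B D\<rbrakk>
          \<Longrightarrow> ar_map L (g \<cdot>\<^bsub>S\<^esub> f) = ar_map L g \<cdot>\<^bsub>T\<^esub> ar_map L f"

locale diagrammatic_logic = cat_functor S T L
  for S :: "('o1, 'a1) cat" and T :: "('o2, 'a2) cat"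
    and L :: "('o1, 'a1, 'o2, 'a2) functor_data" +
  assumes S_has_pushouts: "has_pushouts S"
    and T_has_pushouts: "has_pushouts T"
    and preserves_pushouts: "pushout S f g p q
          \<Longrightarrow> pushout T (ar_map L f) (ar_map L g) (ar_map L p) (ar_map L q)"

definition pleomorphism ::
    "('o1, 'a1) cat \<Rightarrow> ('o2, 'a2) cat \<Rightarrow> ('o1, 'a1, 'o2, 'a2) functor_data \<Rightarrow> 'a1 \<Rightarrow> bool"
  where "pleomorphism S T L f \<longleftrightarrow> f \<in> Ar S \<and> iso T (ar_map L f)"

definition pleoequivalent ::
    "('o1, 'a1) cat \<Rightarrow> ('o2, 'a2) cat \<Rightarrow> ('o1, 'a1, 'o2, 'a2) functor_data \<Rightarrow> 'o1 \<Rightarrow> 'o1 \<Rightarrow> bool"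
  where "pleoequivalent S T L A B \<longleftrightarrow>
    A \<in> Ob S \<and> B \<in> Ob S \<and> isomorphic T (ob_map L A) (ob_map L B)"

definition is_instance ::
    "('o1, 'a1) cat \<Rightarrow> ('o2, 'a2) cat \<Rightarrow> ('o1, 'a1, 'o2, 'a2) functor_data
      \<Rightarrow> 'a1 \<Rightarrow> 'o1 \<Rightarrow> 'o1 \<Rightarrow> bool"
  where "is_instance S T L f A B \<longleftrightarrow> (\<exists>B'. f \<in> Hom S A B' \<and> pleoequivalent S T L B' B)"

definition pleopushout ::
    "('o1, 'a1) cat \<Rightarrow> ('o2, 'a2) cat \<Rightarrow> ('o1, 'a1, 'o2, 'a2) functor_data
      \<Rightarrow> 'a1 \<Rightarrow> 'a1 \<Rightarrow> 'a1 \<Rightarrow> 'a1 \<Rightarrow> 'a1 \<Rightarrow> 'a1 \<Rightarrow> 'a1 \<Rightarrow> bool"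
  where "pleopushout S T L l r \<sigma>\<^sub>H \<sigma>\<^sub>K \<sigma>\<^sub>C l\<^sub>1 r\<^sub>1 \<longleftrightarrow>
    commutative_square S \<sigma>\<^sub>K l l\<^sub>1 \<sigma>\<^sub>H \<and> pleomorphism S T L l\<^sub>1 \<and>
    pushout S r \<sigma>\<^sub>K \<sigma>\<^sub>C r\<^sub>1"

end

theory Submission
  imports Defs
begin

text \<open>Pasting the pleopushout square with the pushout defining \<open>\<Sigma>\<^sub>P\<close> exhibits \<open>\<Sigma>\<^sub>P\<close> as a pushout of
  \<open>r\<close> and \<open>l\<^sub>1 \<cdot> \<sigma>\<^sub>K = \<sigma>\<^sub>H \<cdot> l\<close>; cancelling the pushout \<open>P\<close> of \<open>r\<close> and \<open>l\<close> from it shows that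
  \<open>\<Sigma>\<^sub>P\<close> is also a pushout of \<open>h\<close> and \<open>\<sigma>\<^sub>H\<close>. Since the functor preserves pushouts and isomorphisms are stable
  under pushout, \<open>h\<^sub>1\<close> and \<open>c\<^sub>1\<close> are pleomorphisms along with \<open>h\<close> and \<open>l\<^sub>1\<close>, and then
  \<open>c\<^sub>1 \<cdot> r\<^sub>1 = h\<^sub>1 \<cdot> l\<^sub>1\<close> yields that \<open>r\<^sub>1\<close> is one too.\<close>

section \<open>Squares and pushouts in terms of hom-sets\<close>

lemma Hom_iff: "f \<in> Hom C A B \<longleftrightarrow> f \<in> Ar C \<and> Dom C f = A \<and> Cod C f = B"
  by (simp add: Hom_def)

lemma commutative_square_iff:
  assumes "f \<in> Hom C A B" "g \<in> Hom C A B'"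
  shows "commutative_square C f g p q \<longleftrightarrow>
    (\<exists>D. p \<in> Hom C B D \<and> q \<in> Hom C B' D \<and> p \<cdot>\<^bsub>C\<^esub> f = q \<cdot>\<^bsub>C\<^esub> g)"
  using assms by (auto simp: commutative_square_def Hom_iff)

text \<open>Once the four arrows are typed, a cocone under the span is a pair of arrows out of
  \<open>B\<close> and \<open>B'\<close> with a common target \<open>E\<close>. Naming that target
  replaces the \<open>Dom\<close> and \<open>Cod\<close> conditions by hom-set membership.\<close>

lemma pushout_iff:
  assumes f: "f \<in> Hom C A B" and g: "g \<in> Hom C A B'"
    and p: "p \<in> Hom C B D" and q: "q \<in> Hom C B' D"
  shows "pushout C f g p q \<longleftrightarrow> p \<cdot>\<^bsub>C\<^esub> f = q \<cdot>\<^bsub>C\<^esub> g \<and>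
    (\<forall>E. \<forall>x \<in> Hom C B E. \<forall>y \<in> Hom C B' E. x \<cdot>\<^bsub>C\<^esub> f = y \<cdot>\<^bsub>C\<^esub> g \<longrightarrow>
      (\<exists>!u. u \<in> Hom C D E \<and> u \<cdot>\<^bsub>C\<^esub> p = x \<and> u \<cdot>\<^bsub>C\<^esub> q = y))"
proof -
  \<comment> \<open>Folding the unique-existence claim into \<open>med\<close> keeps it opaque while
    the quantifiers around it are rewritten.\<close>
  define med where "med x y E \<longleftrightarrow> (\<exists>!u. u \<in> Hom C D E \<and> u \<cdot>\<^bsub>C\<^esub> p = x \<and> u \<cdot>\<^bsub>C\<^esub> q = y)" for x y E
  have "commutative_square C f g p q \<longleftrightarrow> p \<cdot>\<^bsub>C\<^esub> f = q \<cdot>\<^bsub>C\<^esub> g"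
    using assms by (auto simp: commutative_square_def Hom_iff)
  then have "pushout C f g p q \<longleftrightarrow> p \<cdot>\<^bsub>C\<^esub> f = q \<cdot>\<^bsub>C\<^esub> g \<and>
      (\<forall>x y. commutative_square C f g x y \<longrightarrow> med x y (Cod C x))"
    using p unfolding pushout_def med_def by (simp add: Hom_iff)
  then show ?thesis
    unfolding med_def[symmetric] commutative_square_iff[OF f g] by (auto simp: Hom_iff)
qed

lemma pushout_commutes: "pushout C f g p q \<Longrightarrow> p \<cdot>\<^bsub>C\<^esub> f = q \<cdot>\<^bsub>C\<^esub> g"
  by (simp add: pushout_def commutative_square_def)

lemma pushout_sym: "pushout C f g p q \<Longrightarrow> pushout C g f q p"
proof -
  assume po: "pushout C f g p q"
  have sym: "commutative_square C g f x y \<longleftrightarrow> commutative_square C f g y x" for x y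
    by (auto simp: commutative_square_def)
  \<comment> \<open>The mediating arrow is typed by the codomains of the first legs. After the swap
    these are \<open>Cod C q\<close> and the codomain of the other leg, so the two typings must be
    seen to agree.\<close>
  have "Cod C p = Cod C q" and "\<And>x y. commutative_square C f g x y \<Longrightarrow> Cod C x = Cod C y"
    using po by (auto simp: pushout_def commutative_square_def)
  with po show ?thesis
    unfolding pushout_def sym by (simp add: conj_commute)
qed

lemma pushout_universal:
  assumes "pushout C f g p q"
    and "f \<in> Hom C A B" "g \<in> Hom C A B'" "p \<in> Hom C B D" "q \<in> Hom C B' D"
    and "x \<in> Hom C B E" "y \<in> Hom C B' E" "x \<cdot>\<^bsub>C\<^esub> f = y \<cdot>\<^bsub>C\<^esub> g"
  shows "\<exists>!u. u \<in> Hom C D E \<and> u \<cdot>\<^bsub>C\<^esub> p = x \<and> u \<cdot>\<^bsub>C\<^esub> q = y"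
  using assms(1) unfolding pushout_iff[OF assms(2-5)] using assms(6-8) by blast

lemma iso_iff:
  assumes "f \<in> Hom C A B"
  shows "iso C f \<longleftrightarrow> (\<exists>g \<in> Hom C B A. g \<cdot>\<^bsub>C\<^esub> f = Ident C A \<and> f \<cdot>\<^bsub>C\<^esub> g = Ident C B)"
  using assms by (auto simp: iso_def Hom_iff)

section \<open>Pasting and cancellation of pushouts\<close>

context category
begin

lemma Hom_Ob: "f \<in> Hom C A B \<Longrightarrow> A \<in> Ob C \<and> B \<in> Ob C"
  using Dom_in_Ob Cod_in_Ob by (auto simp: Hom_iff)

text \<open>The legs of a pushout are jointly epic: \<open>u\<close> and \<open>v\<close> both
  mediate for the cocone \<open>(v \<cdot> p, v \<cdot> q)\<close>.\<close>

lemma pushout_hom_ext: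
  assumes "pushout C f g p q"
    and homs: "f \<in> Hom C A B" "g \<in> Hom C A B'" "p \<in> Hom C B D" "q \<in> Hom C B' D"
    and u: "u \<in> Hom C D E" and v: "v \<in> Hom C D E"
    and "u \<cdot> p = v \<cdot> p" "u \<cdot> q = v \<cdot> q"
  shows "u = v"
proof -
  have "(v \<cdot> p) \<cdot> f = (v \<cdot> q) \<cdot> g"
    using Comp_assoc[OF homs(1,3) v] Comp_assoc[OF homs(2,4) v] pushout_commutes[OF assms(1)]
    by simp
  from pushout_universal[OF assms(1) homs Comp_in_Hom[OF homs(3) v] Comp_in_Hom[OF homs(4) v] this]
  show ?thesis using assms(6-) by blast
qed

text \<open>The two squares share the edge \<open>q\<close>. A mediating arrow is built in two
  stages, through \<open>D\<close> and then through \<open>F\<close>, and its uniqueness is tested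
  on the legs of each square in turn.\<close>

lemma pushout_paste:
  assumes po1: "pushout C f g p q" and po2: "pushout C q k m n"
    and f: "f \<in> Hom C A B" and g: "g \<in> Hom C A B'" and p: "p \<in> Hom C B D"
    and q: "q \<in> Hom C B' D" and k: "k \<in> Hom C B' E" and m: "m \<in> Hom C D F"
    and n: "n \<in> Hom C E F"
  shows "pushout C f (k \<cdot> g) (m \<cdot> p) n"
  unfolding pushout_iff[OF f Comp_in_Hom[OF g k] Comp_in_Hom[OF p m] n]
proof (intro conjI allI ballI impI)
  have "(m \<cdot> p) \<cdot> f = m \<cdot> (q \<cdot> g)"
    using Comp_assoc[OF f p m] pushout_commutes[OF po1] by simp
  also have "\<dots> = (n \<cdot> k) \<cdot> g"
    using Comp_assoc[OF g q m] pushout_commutes[OF po2] by simp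
  also have "\<dots> = n \<cdot> (k \<cdot> g)"
    by (rule Comp_assoc[OF g k n])
  finally show "(m \<cdot> p) \<cdot> f = n \<cdot> (k \<cdot> g)" .
next
  fix X x y
  assume x: "x \<in> Hom C B X" and y: "y \<in> Hom C E X" and eq: "x \<cdot> f = y \<cdot> (k \<cdot> g)"
  have "x \<cdot> f = (y \<cdot> k) \<cdot> g"
    using eq Comp_assoc[OF g k y] by simp
  from pushout_universal[OF po1 f g p q x Comp_in_Hom[OF k y] this]
  \<comment> \<open>The equation \<open>v \<cdot> q = y \<cdot> k\<close> makes
    \<open>(v, y)\<close> a cocone under the second span.\<close>
  obtain v where v: "v \<in> Hom C D X" "v \<cdot> p = x" "v \<cdot> q = y \<cdot> k" by blast
  from pushout_universal[OF po2 q k m n v(1) y v(3)]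
  obtain w where w: "w \<in> Hom C F X" "w \<cdot> m = v" "w \<cdot> n = y" by blast
  show "\<exists>!u. u \<in> Hom C F X \<and> u \<cdot> (m \<cdot> p) = x \<and> u \<cdot> n = y"
  proof (intro ex1I conjI)
    show "w \<in> Hom C F X" "w \<cdot> n = y" by (fact w)+
    show "w \<cdot> (m \<cdot> p) = x" using Comp_assoc[OF p m w(1)] w v by simp
  next
    fix u assume u: "u \<in> Hom C F X \<and> u \<cdot> (m \<cdot> p) = x \<and> u \<cdot> n = y"
    then have uH: "u \<in> Hom C F X" by simp
    have "u \<cdot> m = w \<cdot> m"
    proof (rule pushout_hom_ext[OF po1 f g p q Comp_in_Hom[OF m uH] Comp_in_Hom[OF m w(1)]])
      show "(u \<cdot> m) \<cdot> p = (w \<cdot> m) \<cdot> p"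
        using u v w Comp_assoc[OF p m uH] by simp
      show "(u \<cdot> m) \<cdot> q = (w \<cdot> m) \<cdot> q"
        using u w pushout_commutes[OF po2] Comp_assoc[OF q m uH] Comp_assoc[OF q m w(1)]
          Comp_assoc[OF k n uH] Comp_assoc[OF k n w(1)] by simp
    qed
    then show "u = w"
      using u w by (intro pushout_hom_ext[OF po2 q k m n uH w(1)]) auto
  qed
qed

text \<open>The arrow mediating for \<open>(x \<cdot> p, y)\<close> out of the outer pushout also
  serves the second square, since \<open>p\<close> and \<open>q\<close> are jointly epic. The
  hypothesis \<open>comm\<close> is separate because the outer square gives this equation only after
  composition with \<open>g\<close>.\<close>

lemma pushout_cancel:
  assumes po1: "pushout C f g p q" and po: "pushout C f (k \<cdot> g) (m \<cdot> p) n"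
    and f: "f \<in> Hom C A B" and g: "g \<in> Hom C A B'" and p: "p \<in> Hom C B D"
    and q: "q \<in> Hom C B' D" and k: "k \<in> Hom C B' E" and m: "m \<in> Hom C D F"
    and n: "n \<in> Hom C E F" and comm: "m \<cdot> q = n \<cdot> k"
  shows "pushout C q k m n"
  unfolding pushout_iff[OF q k m n]
proof (intro conjI allI ballI impI)
  show "m \<cdot> q = n \<cdot> k" by (fact comm)
next
  fix X x y
  assume x: "x \<in> Hom C D X" and y: "y \<in> Hom C E X" and eq: "x \<cdot> q = y \<cdot> k"
  note homs = f Comp_in_Hom[OF g k] Comp_in_Hom[OF p m] n
  have "(x \<cdot> p) \<cdot> f = y \<cdot> (k \<cdot> g)"
    using eq pushout_commutes[OF po1] Comp_assoc[OF f p x] Comp_assoc[OF g q x]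
      Comp_assoc[OF g k y] by simp
  from pushout_universal[OF po homs Comp_in_Hom[OF p x] y this]
  obtain w where w: "w \<in> Hom C F X" "w \<cdot> (m \<cdot> p) = x \<cdot> p" "w \<cdot> n = y" by blast
  show "\<exists>!u. u \<in> Hom C F X \<and> u \<cdot> m = x \<and> u \<cdot> n = y"
  proof (intro ex1I conjI)
    show "w \<in> Hom C F X" "w \<cdot> n = y" by (fact w)+
    show "w \<cdot> m = x"
    proof (rule pushout_hom_ext[OF po1 f g p q Comp_in_Hom[OF m w(1)] x])
      show "(w \<cdot> m) \<cdot> p = x \<cdot> p" using w Comp_assoc[OF p m w(1)] by simp
      show "(w \<cdot> m) \<cdot> q = x \<cdot> q"
        using w eq comm Comp_assoc[OF q m w(1)] Comp_assoc[OF k n w(1)] by simp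
    qed
  next
    fix u assume u: "u \<in> Hom C F X \<and> u \<cdot> m = x \<and> u \<cdot> n = y"
    then have uH: "u \<in> Hom C F X" by simp
    show "u = w"
      using u w Comp_assoc[OF p m uH] by (intro pushout_hom_ext[OF po homs uH w(1)]) auto
  qed
qed

section \<open>Isomorphisms and their stability under pushout\<close>

lemma iso_Comp:
  assumes f: "f \<in> Hom C A B" "iso C f" and g: "g \<in> Hom C B D" "iso C g"
  shows "iso C (g \<cdot> f)"
proof -
  obtain f' where f': "f' \<in> Hom C B A" "f' \<cdot> f = Ident C A" "f \<cdot> f' = Ident C B"
    using f(2) unfolding iso_iff[OF f(1)] by blast
  obtain g' where g': "g' \<in> Hom C D B" "g' \<cdot> g = Ident C B" "g \<cdot> g' = Ident C D"
    using g(2) unfolding iso_iff[OF g(1)] by blast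
  have "(f' \<cdot> g') \<cdot> (g \<cdot> f) = f' \<cdot> ((g' \<cdot> g) \<cdot> f)"
    using Comp_assoc[OF Comp_in_Hom[OF f(1) g(1)] g'(1) f'(1)] Comp_assoc[OF f(1) g(1) g'(1)]
    by simp
  then have 1: "(f' \<cdot> g') \<cdot> (g \<cdot> f) = Ident C A"
    using f' g' Ident_Comp[OF f(1)] by simp
  have "(g \<cdot> f) \<cdot> (f' \<cdot> g') = g \<cdot> ((f \<cdot> f') \<cdot> g')"
    using Comp_assoc[OF Comp_in_Hom[OF g'(1) f'(1)] f(1) g(1)] Comp_assoc[OF g'(1) f'(1) f(1)]
    by simp
  then have 2: "(g \<cdot> f) \<cdot> (f' \<cdot> g') = Ident C D"
    using f' g' Ident_Comp[OF g'(1)] by simp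
  show ?thesis
    using 1 2 Comp_in_Hom[OF g'(1) f'(1)] iso_iff[OF Comp_in_Hom[OF f(1) g(1)]] by blast
qed

lemma iso_inverse:
  assumes "f \<in> Hom C A B" "iso C f"
  obtains g where "g \<in> Hom C B A" "g \<cdot> f = Ident C A" "f \<cdot> g = Ident C B" "iso C g"
proof -
  obtain g where "g \<in> Hom C B A" "g \<cdot> f = Ident C A" "f \<cdot> g = Ident C B"
    using assms(2) unfolding iso_iff[OF assms(1)] by blast
  moreover from this have "iso C g"
    using assms(1) by (auto simp: iso_iff)
  ultimately show ?thesis using that by blast
qed

text \<open>Composing with the inverse of \<open>g\<close> recovers \<open>f\<close> as a composite
  of two isomorphisms.\<close>

lemma iso_cancel_left:
  assumes f: "f \<in> Hom C A B" and g: "g \<in> Hom C B D" "iso C g" and gf: "iso C (g \<cdot> f)"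
  shows "iso C f"
proof -
  obtain g' where g': "g' \<in> Hom C D B" "g' \<cdot> g = Ident C B" "iso C g'"
    using iso_inverse[OF g] by blast
  have "f = g' \<cdot> (g \<cdot> f)"
    using Comp_assoc[OF f g(1) g'(1)] g'(2) Ident_Comp[OF f] by simp
  then show ?thesis
    using iso_Comp[OF Comp_in_Hom[OF f g(1)] gf g'(1,3)] by simp
qed

lemma isomorphic_sym: "isomorphic C A B \<Longrightarrow> isomorphic C B A"
  using iso_inverse unfolding isomorphic_def by metis

lemma isomorphic_trans: "isomorphic C A B \<Longrightarrow> isomorphic C B D \<Longrightarrow> isomorphic C A D"
  using iso_Comp Comp_in_Hom unfolding isomorphic_def by metis

text \<open>The inverse of \<open>q\<close> is the arrow induced by the cocone consisting of
  \<open>g \<cdot> f'\<close> and the identity of \<open>B'\<close>.\<close>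

lemma pushout_iso:
  assumes po: "pushout C f g p q" and iso_f: "iso C f"
    and f: "f \<in> Hom C A B" and g: "g \<in> Hom C A B'"
    and p: "p \<in> Hom C B D" and q: "q \<in> Hom C B' D"
  shows "iso C q"
proof -
  obtain f' where f': "f' \<in> Hom C B A" "f' \<cdot> f = Ident C A" "f \<cdot> f' = Ident C B"
    using iso_inverse[OF f iso_f] by blast
  have idB': "Ident C B' \<in> Hom C B' B'" and idD: "Ident C D \<in> Hom C D D"
    using Hom_Ob q Ident_in_Hom by blast+
  have "(g \<cdot> f') \<cdot> f = Ident C B' \<cdot> g"
    using Comp_assoc[OF f f'(1) g] f' Comp_Ident[OF g] Ident_Comp[OF g] by simp
  from pushout_universal[OF po f g p q Comp_in_Hom[OF f'(1) g] idB' this]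
  obtain u where u: "u \<in> Hom C D B'" "u \<cdot> p = g \<cdot> f'" "u \<cdot> q = Ident C B'" by blast
  \<comment> \<open>So far \<open>u\<close> is only a left inverse of \<open>q\<close>; the other
    equation compares two endomorphisms of \<open>D\<close> on the legs \<open>p\<close> and
    \<open>q\<close>.\<close>
  have "q \<cdot> u = Ident C D"
  proof (rule pushout_hom_ext[OF po f g p q Comp_in_Hom[OF u(1) q] idD])
    have "(q \<cdot> u) \<cdot> p = (q \<cdot> g) \<cdot> f'"
      using u Comp_assoc[OF p u(1) q] Comp_assoc[OF f'(1) g q] by simp
    also have "\<dots> = p \<cdot> (f \<cdot> f')"
      using pushout_commutes[OF po] Comp_assoc[OF f'(1) f p] by simp
    finally show "(q \<cdot> u) \<cdot> p = Ident C D \<cdot> p"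
      using f' Comp_Ident[OF p] Ident_Comp[OF p] by simp
    show "(q \<cdot> u) \<cdot> q = Ident C D \<cdot> q"
      using u Comp_assoc[OF q u(1) q] Comp_Ident[OF q] Ident_Comp[OF q] by simp
  qed
  then show ?thesis using u iso_iff[OF q] by blast
qed

end

section \<open>Pleomorphisms and pleoequivalence\<close>

context cat_functor
begin

lemma pleomorphism_cancel_left:
  assumes f: "f \<in> Hom S A B" and g: "g \<in> Hom S B D" "pleomorphism S T L g"
    and gf: "pleomorphism S T L (g \<cdot>\<^bsub>S\<^esub> f)"
  shows "pleomorphism S T L f"
  using T.iso_cancel_left[OF ar_map_in_Hom[OF f] ar_map_in_Hom[OF g(1)]] f g(2) gf
    ar_map_Comp[OF f g(1)] by (simp add: pleomorphism_def Hom_iff)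

lemma pleomorphism_Comp:
  assumes f: "f \<in> Hom S A B" "pleomorphism S T L f" and g: "g \<in> Hom S B D" "pleomorphism S T L g"
  shows "pleomorphism S T L (g \<cdot>\<^bsub>S\<^esub> f)"
  using T.iso_Comp[OF ar_map_in_Hom[OF f(1)] _ ar_map_in_Hom[OF g(1)]] f(2) g(2)
    ar_map_Comp[OF f(1) g(1)] S.Comp_in_Hom[OF f(1) g(1)] by (simp add: pleomorphism_def Hom_iff)

lemma pleomorphism_pleoequivalent:
  assumes "f \<in> Hom S A B" "pleomorphism S T L f"
  shows "pleoequivalent S T L A B"
  using assms ar_map_in_Hom[OF assms(1)] S.Hom_Ob[OF assms(1)]
  by (auto simp: pleoequivalent_def pleomorphism_def isomorphic_def)

lemma pleoequivalent_sym: "pleoequivalent S T L A B \<Longrightarrow> pleoequivalent S T L B A"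
  using T.isomorphic_sym by (auto simp: pleoequivalent_def)

lemma pleoequivalent_trans:
  "pleoequivalent S T L A B \<Longrightarrow> pleoequivalent S T L B D \<Longrightarrow> pleoequivalent S T L A D"
  using T.isomorphic_trans by (auto simp: pleoequivalent_def)

end

text \<open>The image of the square is a pushout in \<open>T\<close>, where
  \<open>pushout_iso\<close> applies.\<close>

lemma (in diagrammatic_logic) pushout_pleomorphism:
  assumes "pushout S f g p q" "pleomorphism S T L f"
    and "f \<in> Hom S A B" "g \<in> Hom S A B'" "p \<in> Hom S B D" "q \<in> Hom S B' D"
  shows "pleomorphism S T L q"
  using T.pushout_iso[OF preserves_pushouts[OF assms(1)]] assms(2-) ar_map_in_Hom
  by (simp add: pleomorphism_def Hom_iff)

text \<open>The pushout claims are made for every mediating \<open>\<sigma>\<^sub>P\<close>; with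
  unique existence this describes the one such arrow.\<close>

theorem theorem1:
  fixes S :: "('o1, 'a1) cat" and T :: "('o2, 'a2) cat"
    and L :: "('o1, 'a1, 'o2, 'a2) functor_data"
    and K H C P \<Sigma>\<^sub>K \<Sigma>\<^sub>H \<Sigma>\<^sub>C \<Sigma>\<^sub>P :: 'o1
    and l r h c \<sigma>\<^sub>K \<sigma>\<^sub>H \<sigma>\<^sub>C l\<^sub>1 r\<^sub>1 h\<^sub>1 c\<^sub>1 :: 'a1
  assumes logic: "diagrammatic_logic S T L"
    and l: "l \<in> Hom S K H" and r: "r \<in> Hom S K C"
    and h: "h \<in> Hom S H P" and c: "c \<in> Hom S C P"
    and rule_pushout: "pushout S l r h c"
    and h_pleo: "pleomorphism S T L h"
    and \<sigma>\<^sub>H: "\<sigma>\<^sub>H \<in> Hom S H \<Sigma>\<^sub>H"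
    and \<sigma>\<^sub>K: "\<sigma>\<^sub>K \<in> Hom S K \<Sigma>\<^sub>K" and \<sigma>\<^sub>C: "\<sigma>\<^sub>C \<in> Hom S C \<Sigma>\<^sub>C"
    and l\<^sub>1: "l\<^sub>1 \<in> Hom S \<Sigma>\<^sub>K \<Sigma>\<^sub>H" and r\<^sub>1: "r\<^sub>1 \<in> Hom S \<Sigma>\<^sub>K \<Sigma>\<^sub>C"
    and pleopo: "pleopushout S T L l r \<sigma>\<^sub>H \<sigma>\<^sub>K \<sigma>\<^sub>C l\<^sub>1 r\<^sub>1"
    and h\<^sub>1: "h\<^sub>1 \<in> Hom S \<Sigma>\<^sub>H \<Sigma>\<^sub>P" and c\<^sub>1: "c\<^sub>1 \<in> Hom S \<Sigma>\<^sub>C \<Sigma>\<^sub>P"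
    and \<Sigma>_pushout: "pushout S l\<^sub>1 r\<^sub>1 h\<^sub>1 c\<^sub>1"
  shows "(\<exists>!\<sigma>\<^sub>P. \<sigma>\<^sub>P \<in> Hom S P \<Sigma>\<^sub>P \<and> \<sigma>\<^sub>P \<cdot>\<^bsub>S\<^esub> h = h\<^sub>1 \<cdot>\<^bsub>S\<^esub> \<sigma>\<^sub>H \<and> \<sigma>\<^sub>P \<cdot>\<^bsub>S\<^esub> c = c\<^sub>1 \<cdot>\<^bsub>S\<^esub> \<sigma>\<^sub>C)
    \<and> (\<forall>\<sigma>\<^sub>P. \<sigma>\<^sub>P \<in> Hom S P \<Sigma>\<^sub>P \<and> \<sigma>\<^sub>P \<cdot>\<^bsub>S\<^esub> h = h\<^sub>1 \<cdot>\<^bsub>S\<^esub> \<sigma>\<^sub>H \<and> \<sigma>\<^sub>P \<cdot>\<^bsub>S\<^esub> c = c\<^sub>1 \<cdot>\<^bsub>S\<^esub> \<sigma>\<^sub>C \<longrightarrow>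
          pushout S l r h c \<and> pushout S l\<^sub>1 r\<^sub>1 h\<^sub>1 c\<^sub>1 \<and>
          pushout S r \<sigma>\<^sub>K \<sigma>\<^sub>C r\<^sub>1 \<and> pushout S h \<sigma>\<^sub>H \<sigma>\<^sub>P h\<^sub>1)
    \<and> pleomorphism S T L h \<and> pleomorphism S T L l\<^sub>1 \<and> pleomorphism S T L r\<^sub>1
    \<and> pleomorphism S T L h\<^sub>1 \<and> pleomorphism S T L c\<^sub>1
    \<and> (\<forall>\<Sigma> \<in> Ob S. is_instance S T L \<sigma>\<^sub>H H \<Sigma> \<longrightarrow> is_instance S T L \<sigma>\<^sub>C C \<Sigma>)"
proof -
  interpret diagrammatic_logic S T L by (fact logic)
  have l\<^sub>1_pleo: "pleomorphism S T L l\<^sub>1" and po: "pushout S r \<sigma>\<^sub>K \<sigma>\<^sub>C r\<^sub>1"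
    and comm: "l\<^sub>1 \<cdot>\<^bsub>S\<^esub> \<sigma>\<^sub>K = \<sigma>\<^sub>H \<cdot>\<^bsub>S\<^esub> l"
    using pleopo by (auto simp: pleopushout_def commutative_square_def)
  \<comment> \<open>The square defining \<open>\<Sigma>\<^sub>P\<close> is transposed so that both
    squares meet along \<open>r\<^sub>1\<close>; \<open>comm\<close> then rewrites the composite
    into \<open>\<Sigma>\<^sub>H\<close>.\<close>
  have outer: "pushout S r (\<sigma>\<^sub>H \<cdot>\<^bsub>S\<^esub> l) (c\<^sub>1 \<cdot>\<^bsub>S\<^esub> \<sigma>\<^sub>C) h\<^sub>1"
    using S.pushout_paste[OF po pushout_sym[OF \<Sigma>_pushout] r \<sigma>\<^sub>K \<sigma>\<^sub>C r\<^sub>1 l\<^sub>1 c\<^sub>1 h\<^sub>1] comm by simp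
  have "(h\<^sub>1 \<cdot>\<^bsub>S\<^esub> \<sigma>\<^sub>H) \<cdot>\<^bsub>S\<^esub> l = (c\<^sub>1 \<cdot>\<^bsub>S\<^esub> \<sigma>\<^sub>C) \<cdot>\<^bsub>S\<^esub> r"
    using pushout_commutes[OF outer] S.Comp_assoc[OF l \<sigma>\<^sub>H h\<^sub>1] by simp
  from pushout_universal[OF rule_pushout l r h c S.Comp_in_Hom[OF \<sigma>\<^sub>H h\<^sub>1] S.Comp_in_Hom[OF \<sigma>\<^sub>C c\<^sub>1] this]
  have ex1: "\<exists>!\<sigma>\<^sub>P. \<sigma>\<^sub>P \<in> Hom S P \<Sigma>\<^sub>P \<and> \<sigma>\<^sub>P \<cdot>\<^bsub>S\<^esub> h = h\<^sub>1 \<cdot>\<^bsub>S\<^esub> \<sigma>\<^sub>H \<and> \<sigma>\<^sub>P \<cdot>\<^bsub>S\<^esub> c = c\<^sub>1 \<cdot>\<^bsub>S\<^esub> \<sigma>\<^sub>C" .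
  \<comment> \<open>Reading \<open>c\<^sub>1 \<cdot> \<sigma>\<^sub>C\<close> as
    \<open>\<sigma>\<^sub>P \<cdot> c\<close> turns \<open>outer\<close> into a pasting whose first
    square is the transposed rule square along \<open>h\<close>.\<close>
  have instance_pushout: "pushout S h \<sigma>\<^sub>H \<sigma>\<^sub>P h\<^sub>1"
    if "\<sigma>\<^sub>P \<in> Hom S P \<Sigma>\<^sub>P" "\<sigma>\<^sub>P \<cdot>\<^bsub>S\<^esub> h = h\<^sub>1 \<cdot>\<^bsub>S\<^esub> \<sigma>\<^sub>H" "\<sigma>\<^sub>P \<cdot>\<^bsub>S\<^esub> c = c\<^sub>1 \<cdot>\<^bsub>S\<^esub> \<sigma>\<^sub>C" for \<sigma>\<^sub>P
    using S.pushout_cancel[OF pushout_sym[OF rule_pushout] _ r l c h \<sigma>\<^sub>H that(1) h\<^sub>1 that(2)]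
      outer that(3) by simp
  obtain \<sigma>\<^sub>P where "\<sigma>\<^sub>P \<in> Hom S P \<Sigma>\<^sub>P" "pushout S h \<sigma>\<^sub>H \<sigma>\<^sub>P h\<^sub>1"
    using ex1 instance_pushout by blast
  then have h\<^sub>1_pleo: "pleomorphism S T L h\<^sub>1"
    using pushout_pleomorphism h_pleo h \<sigma>\<^sub>H h\<^sub>1 by blast
  have c\<^sub>1_pleo: "pleomorphism S T L c\<^sub>1"
    using pushout_pleomorphism[OF \<Sigma>_pushout l\<^sub>1_pleo l\<^sub>1 r\<^sub>1 h\<^sub>1 c\<^sub>1] .
  have r\<^sub>1_pleo: "pleomorphism S T L r\<^sub>1"
    using pleomorphism_cancel_left[OF r\<^sub>1 c\<^sub>1 c\<^sub>1_pleo] pleomorphism_Comp[OF l\<^sub>1 l\<^sub>1_pleo h\<^sub>1 h\<^sub>1_pleo]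
      pushout_commutes[OF \<Sigma>_pushout] by simp
  \<comment> \<open>The span of pleomorphisms \<open>r\<^sub>1\<close> and \<open>l\<^sub>1\<close>
    out of \<open>\<Sigma>\<^sub>K\<close> links the two objects.\<close>
  have "pleoequivalent S T L \<Sigma>\<^sub>C \<Sigma>\<^sub>H"
    using pleomorphism_pleoequivalent[OF r\<^sub>1 r\<^sub>1_pleo] pleomorphism_pleoequivalent[OF l\<^sub>1 l\<^sub>1_pleo]
      pleoequivalent_sym pleoequivalent_trans by blast
  \<comment> \<open>The intermediate object in \<open>is_instance\<close> must be
    \<open>\<Sigma>\<^sub>H\<close>, the codomain of \<open>\<sigma>\<^sub>H\<close>.\<close>
  moreover have "pleoequivalent S T L \<Sigma>\<^sub>H \<Sigma>" if "is_instance S T L \<sigma>\<^sub>H H \<Sigma>" for \<Sigma>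
    using that \<sigma>\<^sub>H by (auto simp: is_instance_def Hom_iff)
  ultimately have "is_instance S T L \<sigma>\<^sub>C C \<Sigma>" if "is_instance S T L \<sigma>\<^sub>H H \<Sigma>" for \<Sigma>
    using that \<sigma>\<^sub>C pleoequivalent_trans unfolding is_instance_def by blast
  then show ?thesis
    using ex1 rule_pushout \<Sigma>_pushout po instance_pushout h_pleo l\<^sub>1_pleo r\<^sub>1_pleo h\<^sub>1_pleo c\<^sub>1_pleo
    by (intro conjI) blast+
qed

end
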